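(* Let $f_{W^1,\ldots,W^L}:\mathbb{R}^N\to\mathbb{R}^{d_L}$ be a neural network with weight matrices $W=(W^1,\ldots,W^L)$, $W^l\in\mathbb{R}^{d_l\times d_{l-1}}$, $d_0=N$, and with continuous piecewise affine activation functions given by slopes $\alpha_i^l$, intercepts $\gamma_i^l$ and interval bounds $\underline{\beta}^{i,l},\overline{\beta}^{i,l}$ ($i\in[k_l]$, $l\in[L]$). Let $\|\cdot\|$ be an arbitrary norm on $\mathbb{R}^{d_L}$, $\bar c\in\mathbb{R}^{d_L}$, $R>0$, and $U_f(W,\bar c,R)=\{c\in\mathbb{R}^N:\|f_{W^1,\ldots,W^L}(c)-\bar c\|\le R\}$. Let $X\subseteq\mathbb{R}^N$ be a polyhedron and $x\in X$. Then the problem $$\max_{c\in U_f(W,\bar c,R)}c^\top x$$ is equivalent to the problem $$\begin{aligned} \max\ & x^\top c^1\\ \text{s.t.}\quad & W^lc^l<\sum_{i\in[k_l]}u^{i,l}\overline{\beta}^{i,l} && \forall l\in[L]\\ & W^lc^l\ge\sum_{i\in[k_l]}u^{i,l}\underline{\beta}^{i,l} && \forall l\in[L]\\ & c^{l+1}=\mathrm{diag}\Big(\sum_{i\in[k_l]}u^{i,l}\alpha_i^l\Big)W^lc^l+\sum_{i\in[k_l]}u^{i,l}\gamma_i^l && \forall l\in[L]\\ & \sum_{i\in[k_l]}u^{i,l}=\mathbf 1 && \forall l\in[L]\\ & \|c^{L+1}-\bar c\|\le R\\ & u^{i,l}\in\{0,1\}^{d_l} && \forall i\in[k_l],\ l\in[L]\\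 & c^l\in\mathbb{R}^{d_{l-1}} && \forall l\in[L+1], \end{aligned}$$ in the sense that a vector $c\in\mathbb{R}^N$ is feasible for the first problem if and only if there is a feasible solution of the second problem with $c^1=c$; since $c^\top x=x^\top c^1$ for such solutions, the two problems have the same optimal value and correspondingly the same optimal $c=c^1$.
   Context: Notation: $[k]=\{1,\ldots,k\}$; $\mathbf 1$ is the all-ones vector; $\mathrm{diag}(v)$ is the diagonal matrix with diagonal $v$; vector inequalities are componentwise. Neural network: $f_{W^1,\ldots,W^L}(c)=\sigma^L(W^L\sigma^{L-1}(W^{L-1}\cdots\sigma^1(W^1c)\cdots))$, where each $\sigma^l:\mathbb{R}\to\mathbb{R}$ is applied componentwise. Activation functions: for each $l\in[L]$, $\sigma^l$ is a continuous function with $\sigma^l(w)=\alpha_i^l w+\gamma_i^l$ whenever $\underline{\beta}^{i,l}\le w\le\overline{\beta}^{i,l}$, $i\in[k_l]$, where $k_l\in\mathbb{N}$, $\alpha_i^l,\gamma_i^l\in\mathbb{R}$, $\underline{\beta}^{i,l}<\overline{\beta}^{i,l}$, $\overline{\beta}^{i,l}=\underline{\beta}^{i+1,l}$ for $i<k_l$, $\underline{\beta}^{1,l}=-\infty$ and $\overline{\beta}^{k_l,l}=\infty$. In the sums $\sum_i u^{i,l}\overline{\beta}^{i,l}$ and $\sum_i u^{i,l}\underline{\beta}^{i,l}$ the convention $0\cdot(\pm\infty)=0$ is used. The variables of the second problem are the vectors $c^l$ ($l\in[L+1]$) and $u^{i,l}$ ($i\in[k_l]$, $l\in[L]$); superscripts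 are indices, not powers. *)

theory Defs
  imports
    Complex_Main
    "HOL-Library.Extended_Real"
    "Jordan_Normal_Form.Matrix"
begin

(* The layer widths d 0, ..., d L are arbitrary and vary inside one statement, so R^n is
   rendered as carrier_vec n.  Layers run over l : {1..L}, pieces over i : {1..k l};
   values of indexed families outside these ranges are irrelevant. *)

definition vec_norm :: "nat \<Rightarrow> (real vec \<Rightarrow> real) \<Rightarrow> bool" where
  "vec_norm n nrm \<longleftrightarrow>
     (\<forall>v \<in> carrier_vec n. 0 \<le> nrm v) \<and>
     (\<forall>v \<in> carrier_vec n. nrm v = 0 \<longleftrightarrow> v = 0\<^sub>v n) \<and>
     (\<forall>a. \<forall>v \<in> carrier_vec n. nrm (a \<cdot>\<^sub>v v) = \<bar>a\<bar> * nrm v) \<and>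
     (\<forall>v \<in> carrier_vec n. \<forall>w \<in> carrier_vec n. nrm (v + w) \<le> nrm v + nrm w)"

(* The order on vec is the componentwise one. *)
definition vec_polyhedron :: "nat \<Rightarrow> real vec set \<Rightarrow> bool" where
  "vec_polyhedron n X \<longleftrightarrow>
     (\<exists>m. \<exists>A \<in> carrier_mat m n. \<exists>b \<in> carrier_vec m. X = {x \<in> carrier_vec n. A *\<^sub>v x \<le> b})"

definition pw_affine_activation ::
  "nat \<Rightarrow> (nat \<Rightarrow> real) \<Rightarrow> (nat \<Rightarrow> real) \<Rightarrow> (nat \<Rightarrow> ereal) \<Rightarrow> (nat \<Rightarrow> ereal) \<Rightarrow> (real \<Rightarrow> real) \<Rightarrow> bool"
where
  "pw_affine_activation k \<alpha> \<gamma> lb ub \<sigma> \<longleftrightarrow>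
     1 \<le> k \<and> continuous_on UNIV \<sigma> \<and>
     lb 1 = -\<infinity> \<and> ub k = \<infinity> \<and>
     (\<forall>i \<in> {1..k}. lb i < ub i) \<and>
     (\<forall>i \<in> {1..<k}. ub i = lb (i + 1)) \<and>
     (\<forall>i \<in> {1..k}. \<forall>w. lb i \<le> ereal w \<and> ereal w \<le> ub i \<longrightarrow> \<sigma> w = \<alpha> i * w + \<gamma> i)"

primrec neural_net :: "(nat \<Rightarrow> real \<Rightarrow> real) \<Rightarrow> (nat \<Rightarrow> real mat) \<Rightarrow> nat \<Rightarrow> real vec \<Rightarrow> real vec" where
  "neural_net \<sigma> W 0 c = c"
| "neural_net \<sigma> W (Suc l) c = map_vec (\<sigma> (Suc l)) (W (Suc l) *\<^sub>v neural_net \<sigma> W l c)"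

definition uncertainty_set ::
  "nat \<Rightarrow> (real vec \<Rightarrow> real vec) \<Rightarrow> (real vec \<Rightarrow> real) \<Rightarrow> real vec \<Rightarrow> real \<Rightarrow> real vec set" where
  "uncertainty_set n f nrm cbar R = {c \<in> carrier_vec n. nrm (f c - cbar) \<le> R}"

abbreviation vec_sum :: "nat \<Rightarrow> nat \<Rightarrow> (nat \<Rightarrow> real vec) \<Rightarrow> real vec" where
  "vec_sum n k v \<equiv> finsum_vec TYPE(real) n v {1..k}"

(* The first two constraint families are stated by components: (<) on vec is not the
   componentwise strict order, and the interval bounds are extended reals, where 0 * \<infinity> = 0
   and 0 * (-\<infinity>) = 0 hold by definition. *)
definition mip_feasible ::
  "nat \<Rightarrow> (nat \<Rightarrow> nat) \<Rightarrow> (nat \<Rightarrow> real mat) \<Rightarrow> (nat \<Rightarrow> nat) \<Rightarrow>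
   (nat \<Rightarrow> nat \<Rightarrow> real) \<Rightarrow> (nat \<Rightarrow> nat \<Rightarrow> real) \<Rightarrow>
   (nat \<Rightarrow> nat \<Rightarrow> ereal) \<Rightarrow> (nat \<Rightarrow> nat \<Rightarrow> ereal) \<Rightarrow>
   (real vec \<Rightarrow> real) \<Rightarrow> real vec \<Rightarrow> real \<Rightarrow>
   ((nat \<Rightarrow> real vec) \<times> (nat \<Rightarrow> nat \<Rightarrow> real vec)) set"
where
  "mip_feasible L d W k \<alpha> \<gamma> lb ub nrm cbar R = {(c, u).
     (\<forall>l \<in> {1..L}. \<forall>j < d l.
        ereal ((W l *\<^sub>v c l) $ j) < (\<Sum>i \<in> {1..k l}. ereal (u l i $ j) * ub l i)) \<and>
     (\<forall>l \<in> {1..L}. \<forall>j < d l.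
        ereal ((W l *\<^sub>v c l) $ j) \<ge> (\<Sum>i \<in> {1..k l}. ereal (u l i $ j) * lb l i)) \<and>
     (\<forall>l \<in> {1..L}.
        c (l + 1) =
          mat_diag (d l) (\<lambda>j. vec_sum (d l) (k l) (\<lambda>i. \<alpha> l i \<cdot>\<^sub>v u l i) $ j) *\<^sub>v (W l *\<^sub>v c l)
          + vec_sum (d l) (k l) (\<lambda>i. \<gamma> l i \<cdot>\<^sub>v u l i)) \<and>
     (\<forall>l \<in> {1..L}. vec_sum (d l) (k l) (\<lambda>i. u l i) = vec (d l) (\<lambda>_. 1)) \<and>
     nrm (c (L + 1) - cbar) \<le> R \<and>
     (\<forall>l \<in> {1..L}. \<forall>i \<in> {1..k l}.
        u l i \<in> carrier_vec (d l) \<and> (\<forall>j < d l. u l i $ j \<in> {0, 1})) \<and>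
     (\<forall>l \<in> {1..L + 1}. c l \<in> carrier_vec (d (l - 1)))}"

(* Supremum of the objective: -\<infinity> for an infeasible problem, \<infinity> for an unbounded one. *)
definition opt_value :: "('a \<Rightarrow> real) \<Rightarrow> 'a set \<Rightarrow> ereal" where
  "opt_value obj F = (SUP z \<in> F. ereal (obj z))"

definition opt_solution :: "('a \<Rightarrow> real) \<Rightarrow> 'a set \<Rightarrow> 'a \<Rightarrow> bool" where
  "opt_solution obj F = is_arg_max obj (\<lambda>z. z \<in> F)"

end

theory Submission
  imports Defs
begin

text \<open>The constraints of a layer force, for each neuron, exactly one of the binary variables to be 1,
  namely the one belonging to the half-open piece [lb, ub) containing the preactivation.
  These pieces partition the real line, so the binary variables exist and are determined by
  the preactivations, and the affine recursion then computes the network layer by layer.\<close>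

section \<open>Half-open pieces of an activation function\<close>

lemma pw_affine_piece:
  assumes "pw_affine_activation k \<alpha> \<gamma> lb ub \<sigma>"
  obtains i where "i \<in> {1..k}" "lb i \<le> ereal w" "ereal w < ub i"
proof -
  define S where "S = {i \<in> {1..k}. lb i \<le> ereal w}"
  have S: "finite S" "1 \<in> S"
    using assms by (auto simp: S_def pw_affine_activation_def)
  \<comment> \<open>The last piece that starts at or below \<open>w\<close>; piece 1 is always a
    candidate because \<open>lb 1\<close> is -\<infinity>. If \<open>m < k\<close>, the next piece
    starts at \<open>ub m\<close> and, by maximality, above \<open>w\<close>, so the upper bound is
    strict.\<close>
  define m where "m = Max S"
  have m: "m \<in> S" and max: "\<And>i. i \<in> S \<Longrightarrow> i \<le> m"
    unfolding m_def using S Max_in by auto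
  have "ereal w < ub m"
  proof (cases "m = k")
    case True
    then show ?thesis using assms by (simp add: pw_affine_activation_def)
  next
    case False
    with m have range: "m \<in> {1..<k}" by (auto simp: S_def)
    then have "ub m = lb (m + 1)" using assms by (simp add: pw_affine_activation_def)
    moreover have "m + 1 \<notin> S" using max by fastforce
    ultimately show ?thesis using range by (simp add: S_def not_le)
  qed
  with m show ?thesis by (intro that) (auto simp: S_def)
qed

lemma pw_affine_value:
  assumes "pw_affine_activation k \<alpha> \<gamma> lb ub \<sigma>"
    and "i \<in> {1..k}" "lb i \<le> ereal w" "ereal w < ub i"
  shows "\<sigma> w = \<alpha> i * w + \<gamma> i"
  using assms by (auto simp: pw_affine_activation_def less_imp_le)

section \<open>Sums selected by binary variables\<close>

lemma binary_sum_one_unit: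
  fixes b :: "'a \<Rightarrow> real"
  assumes "finite S" "\<And>i. i \<in> S \<Longrightarrow> b i \<in> {0, 1}" "sum b S = 1"
  obtains i\<^sub>0 where "i\<^sub>0 \<in> S" "\<And>i. i \<in> S \<Longrightarrow> b i = (if i = i\<^sub>0 then 1 else 0)"
proof -
  obtain i\<^sub>0 where i0: "i\<^sub>0 \<in> S" "b i\<^sub>0 \<noteq> 0"
    using assms(3) by (metis sum.neutral zero_neq_one)
  have b0: "b i\<^sub>0 = 1" using assms(2)[OF i0(1)] i0(2) by simp
  \<comment> \<open>The entry at \<open>i\<^sub>0\<close> already uses up the total 1. The others
    are nonnegative, so a zero sum makes each of them vanish.\<close>
  have "sum b (S - {i\<^sub>0}) = 0"
    using sum.remove[OF assms(1) i0(1), of b] assms(3) b0 by simp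
  then have "\<forall>i \<in> S - {i\<^sub>0}. b i = 0"
    using assms(1,2) by (subst (asm) sum_nonneg_eq_0_iff) force+
  with that[OF i0(1)] b0 show ?thesis by auto
qed

text \<open>Terms off \<open>i\<^sub>0\<close> vanish even where \<open>g\<close> is infinite, since
  0 times an infinite value is 0 in \<open>ereal\<close>. This turns the bound sums of the program
  into one interval endpoint, possibly infinite.\<close>

lemma sum_unit_ereal_mult:
  fixes g :: "'a \<Rightarrow> ereal"
  assumes "finite S" "i\<^sub>0 \<in> S" "\<And>i. i \<in> S \<Longrightarrow> b i = (if i = i\<^sub>0 then 1 else 0)"
  shows "(\<Sum>i\<in>S. ereal (b i) * g i) = g i\<^sub>0"
proof -
  have "(\<Sum>i\<in>S. ereal (b i) * g i) = (\<Sum>i\<in>S. if i = i\<^sub>0 then g i else 0)"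
    using assms(3) by (intro sum.cong) (auto simp flip: zero_ereal_def one_ereal_def)
  with assms(1,2) show ?thesis by simp
qed

lemma sum_unit_mult:
  fixes g :: "'a \<Rightarrow> real"
  assumes "finite S" "i\<^sub>0 \<in> S" "\<And>i. i \<in> S \<Longrightarrow> b i = (if i = i\<^sub>0 then 1 else 0)"
  shows "(\<Sum>i\<in>S. g i * b i) = g i\<^sub>0"
proof -
  have "(\<Sum>i\<in>S. g i * b i) = (\<Sum>i\<in>S. if i = i\<^sub>0 then g i else 0)"
    using assms(3) by (intro sum.cong) auto
  with assms(1,2) show ?thesis by simp
qed

section \<open>Coordinates of vector sums and of the affine update\<close>

lemma vec_sum_index:
  assumes "j < n" "\<And>i. i \<in> {1..k} \<Longrightarrow> v i \<in> carrier_vec n"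
  shows "vec_sum n k v $ j = (\<Sum>i\<in>{1..k}. v i $ j)"
  using assms by (intro index_finsum_vec) auto

lemma vec_sum_carrier:
  assumes "\<And>i. i \<in> {1..k} \<Longrightarrow> v i \<in> carrier_vec n"
  shows "vec_sum n k v \<in> carrier_vec n"
  using assms by (intro finsum_vec_closed) auto

lemma mat_diag_mult_vec_index:
  fixes f :: "nat \<Rightarrow> 'a :: comm_semiring_0"
  assumes "v \<in> carrier_vec n" "j < n"
  shows "(mat_diag n f *\<^sub>v v) $ j = f j * v $ j"
proof -
  have "(mat_diag n f *\<^sub>v v) $ j = (\<Sum>i = 0..<n. (if j = i then f i else 0) * v $ i)"
    using assms by (simp add: scalar_prod_def mat_diag_def)
  also have "\<dots> = (\<Sum>i = 0..<n. if i = j then f i * v $ i else 0)"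
    by (intro sum.cong) auto
  also have "\<dots> = f j * v $ j"
    using assms(2) by simp
  finally show ?thesis .
qed

text \<open>At coordinate \<open>j\<close> the selector leaves one slope and one intercept, so the
  update acts there as a scalar affine map. Only one coordinate is fixed because
  \<open>i\<^sub>0\<close> may differ from neuron to neuron.\<close>

lemma layer_affine_index:
  assumes "w \<in> carrier_vec n" "j < n"
    and "\<And>i. i \<in> {1..k} \<Longrightarrow> u i \<in> carrier_vec n"
    and "i\<^sub>0 \<in> {1..k}" "\<And>i. i \<in> {1..k} \<Longrightarrow> u i $ j = (if i = i\<^sub>0 then 1 else 0)"
  shows "(mat_diag n (\<lambda>j. vec_sum n k (\<lambda>i. \<alpha> i \<cdot>\<^sub>v u i) $ j) *\<^sub>v w
           + vec_sum n k (\<lambda>i. \<gamma> i \<cdot>\<^sub>v u i)) $ j = \<alpha> i\<^sub>0 * w $ j + \<gamma> i\<^sub>0"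
proof -
  have coord: "vec_sum n k (\<lambda>i. g i \<cdot>\<^sub>v u i) $ j = g i\<^sub>0" for g :: "nat \<Rightarrow> real"
  proof -
    have "vec_sum n k (\<lambda>i. g i \<cdot>\<^sub>v u i) $ j = (\<Sum>i\<in>{1..k}. (g i \<cdot>\<^sub>v u i) $ j)"
      using assms by (intro vec_sum_index) auto
    also have "\<dots> = (\<Sum>i\<in>{1..k}. g i * u i $ j)"
      using assms(2) assms(3)[THEN carrier_vecD] by (intro sum.cong) auto
    also have "\<dots> = g i\<^sub>0"
      using assms(4,5) by (intro sum_unit_mult) auto
    finally show ?thesis .
  qed
  have "vec_sum n k (\<lambda>i. \<gamma> i \<cdot>\<^sub>v u i) \<in> carrier_vec n"
    using assms(3) by (intro vec_sum_carrier) auto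
  with assms(1,2) show ?thesis
    by (simp add: mat_diag_mult_vec_index coord del: One_nat_def)
qed

section \<open>The constraints of a single layer\<close>

definition layer_feasible ::
  "nat \<Rightarrow> nat \<Rightarrow> (nat \<Rightarrow> real) \<Rightarrow> (nat \<Rightarrow> real) \<Rightarrow> (nat \<Rightarrow> ereal) \<Rightarrow> (nat \<Rightarrow> ereal) \<Rightarrow>
   real vec \<Rightarrow> real vec \<Rightarrow> (nat \<Rightarrow> real vec) \<Rightarrow> bool" where
  "layer_feasible n k \<alpha> \<gamma> lb ub w c' u \<longleftrightarrow>
     (\<forall>j < n. ereal (w $ j) < (\<Sum>i \<in> {1..k}. ereal (u i $ j) * ub i)) \<and>
     (\<forall>j < n. ereal (w $ j) \<ge> (\<Sum>i \<in> {1..k}. ereal (u i $ j) * lb i)) \<and>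
     c' = mat_diag n (\<lambda>j. vec_sum n k (\<lambda>i. \<alpha> i \<cdot>\<^sub>v u i) $ j) *\<^sub>v w
          + vec_sum n k (\<lambda>i. \<gamma> i \<cdot>\<^sub>v u i) \<and>
     vec_sum n k (\<lambda>i. u i) = vec n (\<lambda>_. 1) \<and>
     (\<forall>i \<in> {1..k}. u i \<in> carrier_vec n \<and> (\<forall>j < n. u i $ j \<in> {0, 1}))"

text \<open>Collecting the constraint families by layer shows that layers interact only through
  \<open>c (l + 1)\<close>, the output of layer \<open>l\<close> and the input of the next
  one.\<close>

lemma mip_feasible_iff_layers:
  "(c, u) \<in> mip_feasible L d W k \<alpha> \<gamma> lb ub nrm cbar R \<longleftrightarrow>
     (\<forall>l \<in> {1..L}. layer_feasible (d l) (k l) (\<alpha> l) (\<gamma> l) (lb l) (ub l)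
        (W l *\<^sub>v c l) (c (l + 1)) (u l)) \<and>
     nrm (c (L + 1) - cbar) \<le> R \<and>
     (\<forall>l \<in> {1..L + 1}. c l \<in> carrier_vec (d (l - 1)))"
  unfolding mip_feasible_def layer_feasible_def mem_Collect_eq case_prod_conv by blast

text \<open>The selected piece contains the preactivation by the bound constraints, and on that
  piece the activation has exactly the slope and intercept used in the update.\<close>

lemma layer_feasible_activation:
  assumes act: "pw_affine_activation k \<alpha> \<gamma> lb ub \<sigma>"
    and w: "w \<in> carrier_vec n"
    and feas: "layer_feasible n k \<alpha> \<gamma> lb ub w c' u"
  shows "c' = map_vec \<sigma> w"
proof
  have c': "c' = mat_diag n (\<lambda>j. vec_sum n k (\<lambda>i. \<alpha> i \<cdot>\<^sub>v u i) $ j) *\<^sub>v w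
      + vec_sum n k (\<lambda>i. \<gamma> i \<cdot>\<^sub>v u i)"
    and one: "vec_sum n k (\<lambda>i. u i) = vec n (\<lambda>_. 1)"
    and u: "\<And>i. i \<in> {1..k} \<Longrightarrow> u i \<in> carrier_vec n"
    and bin: "\<And>i j. i \<in> {1..k} \<Longrightarrow> j < n \<Longrightarrow> u i $ j \<in> {0, 1}"
    using feas by (auto simp only: layer_feasible_def)
  have "vec_sum n k (\<lambda>i. \<gamma> i \<cdot>\<^sub>v u i) \<in> carrier_vec n"
    using u by (intro vec_sum_carrier) auto
  then show "dim_vec c' = dim_vec (map_vec \<sigma> w)"
    using w by (simp add: c')
  fix j assume "j < dim_vec (map_vec \<sigma> w)"
  then have j: "j < n" using w by simp
  \<comment> \<open>Coordinate \<open>j\<close> of the all-ones constraint: a binary family with sum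
    1 selects a single piece.\<close>
  have "(\<Sum>i\<in>{1..k}. u i $ j) = 1"
    using vec_sum_index[where v = u and k = k, OF j u] one j by simp
  then obtain i\<^sub>0 where i0: "i\<^sub>0 \<in> {1..k}"
      "\<And>i. i \<in> {1..k} \<Longrightarrow> u i $ j = (if i = i\<^sub>0 then 1 else 0)"
    using binary_sum_one_unit[of "{1..k}" "\<lambda>i. u i $ j"] bin j by auto
  have sel: "(\<Sum>i\<in>{1..k}. ereal (u i $ j) * g i) = g i\<^sub>0" for g
    using i0 by (intro sum_unit_ereal_mult) auto
  have "(\<Sum>i\<in>{1..k}. ereal (u i $ j) * lb i) \<le> ereal (w $ j)"
    and "ereal (w $ j) < (\<Sum>i\<in>{1..k}. ereal (u i $ j) * ub i)"
    using feas j by (simp_all only: layer_feasible_def)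
  then have "\<sigma> (w $ j) = \<alpha> i\<^sub>0 * w $ j + \<gamma> i\<^sub>0"
    using pw_affine_value[OF act i0(1)] unfolding sel by blast
  then show "c' $ j = map_vec \<sigma> w $ j"
    unfolding c' using layer_affine_index[OF w j u i0] w j by simp
qed

text \<open>The pieces cover the real line, so each neuron can select the piece that its
  preactivation lies in; this selection satisfies all constraints of the layer.\<close>

lemma layer_feasible_exists:
  assumes act: "pw_affine_activation k \<alpha> \<gamma> lb ub \<sigma>"
    and w: "w \<in> carrier_vec n"
  shows "\<exists>u. layer_feasible n k \<alpha> \<gamma> lb ub w (map_vec \<sigma> w) u"
proof -
  \<comment> \<open>For \<open>j \<ge> n\<close> the entry \<open>w $ j\<close> is an unspecified
    real, but it still lies in some piece, so the choice function can be total.\<close>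
  have "\<forall>j. \<exists>i. i \<in> {1..k} \<and> lb i \<le> ereal (w $ j) \<and> ereal (w $ j) < ub i"
    using pw_affine_piece[OF act] by blast
  then obtain p where p: "\<And>j. p j \<in> {1..k}" "\<And>j. lb (p j) \<le> ereal (w $ j)"
      "\<And>j. ereal (w $ j) < ub (p j)"
    by metis
  \<comment> \<open>Indicator vector of the neurons whose chosen piece is \<open>i\<close>.\<close>
  define u where "u i = vec n (\<lambda>j. if i = p j then 1 else 0 :: real)" for i
  have u: "\<And>i. u i \<in> carrier_vec n"
    and uj: "\<And>i j. j < n \<Longrightarrow> u i $ j = (if i = p j then 1 else 0)"
    by (auto simp: u_def)
  have sel: "(\<Sum>i\<in>{1..k}. ereal (u i $ j) * g i) = g (p j)" if "j < n" for g j
    using p(1) uj that by (intro sum_unit_ereal_mult) auto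
  have "vec_sum n k (\<lambda>i. \<gamma> i \<cdot>\<^sub>v u i) \<in> carrier_vec n"
    using u by (intro vec_sum_carrier) auto
  then have "map_vec \<sigma> w = mat_diag n (\<lambda>j. vec_sum n k (\<lambda>i. \<alpha> i \<cdot>\<^sub>v u i) $ j) *\<^sub>v w
      + vec_sum n k (\<lambda>i. \<gamma> i \<cdot>\<^sub>v u i)" (is "_ = ?r")
  proof (intro eq_vecI)
    fix j assume "j < dim_vec ?r"
    with \<open>vec_sum n k _ \<in> _\<close> have j: "j < n" by simp
    show "map_vec \<sigma> w $ j = ?r $ j"
      using layer_affine_index[OF w j u p(1) uj[OF j]] pw_affine_value[OF act p] w j by simp
  qed (use w in simp)
  moreover have "vec_sum n k (\<lambda>i. u i) = vec n (\<lambda>_. 1)"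
  proof
    fix j assume "j < dim_vec (vec n (\<lambda>_. 1 :: real))"
    then have j: "j < n" by simp
    \<comment> \<open>The factor 1 makes this an instance of \<open>sum_unit_mult\<close> with
      constant weight 1.\<close>
    have "vec_sum n k u $ j = (\<Sum>i\<in>{1..k}. 1 * u i $ j)"
      using vec_sum_index[where v = u, OF j u] by simp
    also have "\<dots> = 1"
      using p(1) uj[OF j] by (intro sum_unit_mult) auto
    finally show "vec_sum n k (\<lambda>i. u i) $ j = vec n (\<lambda>_. 1) $ j" using j by simp
  qed (use vec_sum_carrier[of k u n] u in auto)
  moreover have "\<forall>j < n. ereal (w $ j) < (\<Sum>i\<in>{1..k}. ereal (u i $ j) * ub i)"
    and "\<forall>j < n. (\<Sum>i\<in>{1..k}. ereal (u i $ j) * lb i) \<le> ereal (w $ j)"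
    using p(2,3) sel by force+
  moreover have "\<forall>i \<in> {1..k}. u i \<in> carrier_vec n \<and> (\<forall>j < n. u i $ j \<in> {0, 1})"
    using u uj by simp
  ultimately have "layer_feasible n k \<alpha> \<gamma> lb ub w (map_vec \<sigma> w) u"
    unfolding layer_feasible_def by blast
  then show ?thesis by blast
qed

section \<open>Composition of the layers\<close>

lemma neural_net_carrier:
  assumes "\<And>l. l \<in> {1..L} \<Longrightarrow> W l \<in> carrier_mat (d l) (d (l - 1))"
    and "c \<in> carrier_vec (d 0)" "l \<le> L"
  shows "neural_net \<sigma> W l c \<in> carrier_vec (d l)"
  using assms(3)
proof (induction l)
  case (Suc l)
  then show ?case using assms(1)[of "Suc l"] by auto
qed (use assms(2) in simp)

text \<open>Induction over the layers, each of which forces its output. The index is shifted by one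
  because \<open>cs 1\<close> is the input, so \<open>cs (Suc l)\<close> is the state after
  \<open>l\<close> layers.\<close>

lemma mip_feasible_neural_net:
  assumes W: "\<And>l. l \<in> {1..L} \<Longrightarrow> W l \<in> carrier_mat (d l) (d (l - 1))"
    and act: "\<And>l. l \<in> {1..L} \<Longrightarrow> pw_affine_activation (k l) (\<alpha> l) (\<gamma> l) (lb l) (ub l) (\<sigma> l)"
    and feas: "(cs, u) \<in> mip_feasible L d W k \<alpha> \<gamma> lb ub nrm cbar R"
    and "l \<le> L"
  shows "cs (Suc l) = neural_net \<sigma> W l (cs 1)"
  using \<open>l \<le> L\<close>
proof (induction l)
  case (Suc l)
  then have l: "Suc l \<in> {1..L}" by simp
  have "cs (Suc l) \<in> carrier_vec (d l)"
    using feas l unfolding mip_feasible_iff_layers by force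
  moreover have "layer_feasible (d (Suc l)) (k (Suc l)) (\<alpha> (Suc l)) (\<gamma> (Suc l)) (lb (Suc l)) (ub (Suc l))
      (W (Suc l) *\<^sub>v cs (Suc l)) (cs (Suc (Suc l))) (u (Suc l))"
    using feas l unfolding mip_feasible_iff_layers by simp
  ultimately have "cs (Suc (Suc l)) = map_vec (\<sigma> (Suc l)) (W (Suc l) *\<^sub>v cs (Suc l))"
    using W[OF l] by (intro layer_feasible_activation[OF act[OF l]]) auto
  with Suc show ?case by simp
qed simp

lemma mip_feasible_exists:
  assumes W: "\<And>l. l \<in> {1..L} \<Longrightarrow> W l \<in> carrier_mat (d l) (d (l - 1))"
    and act: "\<And>l. l \<in> {1..L} \<Longrightarrow> pw_affine_activation (k l) (\<alpha> l) (\<gamma> l) (lb l) (ub l) (\<sigma> l)"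
    and c: "c \<in> carrier_vec (d 0)"
    and bound: "nrm (neural_net \<sigma> W L c - cbar) \<le> R"
  shows "\<exists>cs u. (cs, u) \<in> mip_feasible L d W k \<alpha> \<gamma> lb ub nrm cbar R \<and> cs 1 = c"
proof -
  \<comment> \<open>The state entering layer \<open>l\<close>, hence after \<open>l - 1\<close>
    layers. Truncated subtraction gives \<open>cs 0 = c\<close>, a value that no constraint
    mentions.\<close>
  define cs where "cs l = neural_net \<sigma> W (l - 1) c" for l
  have cs: "cs l \<in> carrier_vec (d (l - 1))" if "l \<in> {1..L + 1}" for l
    using neural_net_carrier[OF W c, of L "l - 1"] that by (auto simp: cs_def)
  have step: "cs (l + 1) = map_vec (\<sigma> l) (W l *\<^sub>v cs l)" if "l \<in> {1..L}" for l
    using that by (cases l) (auto simp: cs_def)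
  have "\<exists>v. layer_feasible (d l) (k l) (\<alpha> l) (\<gamma> l) (lb l) (ub l) (W l *\<^sub>v cs l) (cs (l + 1)) v"
    if l: "l \<in> {1..L}" for l
    unfolding step[OF l] using W[OF l] cs[of l] l
    by (intro layer_feasible_exists[OF act[OF l]]) auto
  \<comment> \<open>Once the states are fixed, no constraint links the binary variables of different
    layers, so they can be chosen layer by layer.\<close>
  then obtain u where "\<forall>l \<in> {1..L}.
      layer_feasible (d l) (k l) (\<alpha> l) (\<gamma> l) (lb l) (ub l) (W l *\<^sub>v cs l) (cs (l + 1)) (u l)"
    by metis
  with cs bound have "(cs, u) \<in> mip_feasible L d W k \<alpha> \<gamma> lb ub nrm cbar R"
    unfolding mip_feasible_iff_layers by (simp add: cs_def)
  moreover have "cs 1 = c" by (simp add: cs_def)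
  ultimately show ?thesis by blast
qed

text \<open>Projecting a feasible solution to its first state loses only data determined by the
  network or chosen per layer. As a set identity, this lets the optimization claims follow from
  general facts about images.\<close>

lemma uncertainty_set_eq_mip_image:
  assumes W: "\<And>l. l \<in> {1..L} \<Longrightarrow> W l \<in> carrier_mat (d l) (d (l - 1))"
    and act: "\<And>l. l \<in> {1..L} \<Longrightarrow> pw_affine_activation (k l) (\<alpha> l) (\<gamma> l) (lb l) (ub l) (\<sigma> l)"
  shows "uncertainty_set (d 0) (neural_net \<sigma> W L) nrm cbar R =
    (\<lambda>(cs, u). cs 1) ` mip_feasible L d W k \<alpha> \<gamma> lb ub nrm cbar R" (is "?U = _ ` ?F")
proof (intro equalityI subsetI)
  fix c assume "c \<in> ?U"
  then have "c \<in> carrier_vec (d 0)" "nrm (neural_net \<sigma> W L c - cbar) \<le> R"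
    by (auto simp: uncertainty_set_def)
  with W act have "\<exists>cs u. (cs, u) \<in> ?F \<and> cs 1 = c"
    by (rule mip_feasible_exists)
  then show "c \<in> (\<lambda>(cs, u). cs 1) ` ?F"
    by force
next
  fix c assume "c \<in> (\<lambda>(cs, u). cs 1) ` ?F"
  then obtain cs u where feas: "(cs, u) \<in> ?F" and c: "c = cs 1" by auto
  have "cs 1 \<in> carrier_vec (d 0)" "nrm (cs (Suc L) - cbar) \<le> R"
    using feas unfolding mip_feasible_iff_layers by force+
  with c mip_feasible_neural_net[OF W act feas, of L] show "c \<in> ?U"
    by (simp add: uncertainty_set_def)
qed

section \<open>Optimal values and solutions under projection\<close>

lemma opt_value_image:
  assumes "\<And>z. z \<in> F \<Longrightarrow> g z = f (h z)"
  shows "opt_value f (h ` F) = opt_value g F"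
  \<comment> \<open>Both suprema range over the same objective values, which covers infeasible and
    unbounded problems as well.\<close>
  unfolding opt_value_def image_image using assms by (intro SUP_cong) simp_all

text \<open>Since objective values agree along \<open>h\<close>, comparing with all of the image is
  the same as comparing with all of \<open>F\<close>; thus every preimage in \<open>F\<close> of an
  optimum is itself optimal.\<close>

lemma opt_solution_image:
  assumes "\<And>z. z \<in> F \<Longrightarrow> g z = f (h z)"
  shows "opt_solution f (h ` F) c \<longleftrightarrow> (\<exists>z. opt_solution g F z \<and> h z = c)"
  using assms by (auto simp: opt_solution_def is_arg_max_def)

theorem theorem3:
  fixes L N :: nat and d k :: "nat \<Rightarrow> nat"
    and W :: "nat \<Rightarrow> real mat"
    and \<sigma> :: "nat \<Rightarrow> real \<Rightarrow> real"
    and \<alpha> \<gamma> :: "nat \<Rightarrow> nat \<Rightarrow> real"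
    and lb ub :: "nat \<Rightarrow> nat \<Rightarrow> ereal"
    and nrm :: "real vec \<Rightarrow> real"
    and cbar x :: "real vec" and R :: real and X :: "real vec set"
  defines "U \<equiv> uncertainty_set N (neural_net \<sigma> W L) nrm cbar R"
    and "F \<equiv> mip_feasible L d W k \<alpha> \<gamma> lb ub nrm cbar R"
  assumes "d 0 = N"
    and "\<And>l. l \<in> {1..L} \<Longrightarrow> W l \<in> carrier_mat (d l) (d (l - 1))"
    and "\<And>l. l \<in> {1..L} \<Longrightarrow> pw_affine_activation (k l) (\<alpha> l) (\<gamma> l) (lb l) (ub l) (\<sigma> l)"
    and "vec_norm (d L) nrm"
    and "cbar \<in> carrier_vec (d L)"
    and "R > 0"
    and "vec_polyhedron N X" and "x \<in> X"
  shows "(\<forall>c \<in> carrier_vec N. c \<in> U \<longleftrightarrow> (\<exists>(cs, u) \<in> F. cs 1 = c))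
    \<and> (\<forall>(cs, u) \<in> F. cs 1 \<bullet> x = x \<bullet> cs 1)
    \<and> opt_value (\<lambda>c. c \<bullet> x) U = opt_value (\<lambda>(cs, u). x \<bullet> cs 1) F
    \<and> (\<forall>c \<in> carrier_vec N. opt_solution (\<lambda>c. c \<bullet> x) U c \<longleftrightarrow>
         (\<exists>cs u. opt_solution (\<lambda>(cs, u). x \<bullet> cs 1) F (cs, u) \<and> cs 1 = c))"
proof -
  note W = assms(4) and act = assms(5)
  let ?h = "\<lambda>(cs, u). cs (1::nat)"
  have UF: "U = ?h ` F"
    unfolding U_def F_def assms(3)[symmetric] using W act by (rule uncertainty_set_eq_mip_image)
  \<comment> \<open>Membership in the polyhedron supplies the dimension of \<open>x\<close>, which
    commuting the scalar product requires.\<close>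
  have x: "x \<in> carrier_vec N"
    using assms(9,10) by (auto simp: vec_polyhedron_def)
  have U_carrier: "U \<subseteq> carrier_vec N"
    by (auto simp: U_def uncertainty_set_def)
  have obj: "(\<lambda>(cs, u). x \<bullet> cs 1) z = ?h z \<bullet> x" if "z \<in> F" for z
  proof -
    \<comment> \<open>The dimension of the first state is read off from the projection landing in
      \<open>U\<close>.\<close>
    have "?h z \<in> carrier_vec N" using that UF U_carrier by blast
    with x show ?thesis by (auto simp: comm_scalar_prod split: prod.split)
  qed
  have "c \<in> U \<longleftrightarrow> (\<exists>(cs, u) \<in> F. cs 1 = c)" for c
    unfolding UF by auto
  moreover have "\<forall>(cs, u) \<in> F. cs 1 \<bullet> x = x \<bullet> cs 1"
    using obj by fastforce
  moreover have "opt_value (\<lambda>c. c \<bullet> x) U = opt_value (\<lambda>(cs, u). x \<bullet> cs 1) F"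
    unfolding UF using obj by (rule opt_value_image)
  moreover have "opt_solution (\<lambda>c. c \<bullet> x) U c \<longleftrightarrow>
      (\<exists>cs u. opt_solution (\<lambda>(cs, u). x \<bullet> cs 1) F (cs, u) \<and> cs 1 = c)" for c
    unfolding UF using opt_solution_image[where f = "\<lambda>c. c \<bullet> x" and h = ?h, OF obj, where c = c] by auto
  ultimately show ?thesis by blast
qed

end
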